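(* Let $w_1,w_2,w_3$ be any odd positive integers. Then for every integer $n\ge 0$ and every $y_1\in\mathbb{Z}_p$, the following three expressions are equal: \begin{align*} &(w_1w_2)^n\sum_{a=0}^{w_1d-1}\sum_{b=0}^{w_2d-1}(-1)^{a+b}\chi(ab)E_{n,\chi}\Big(w_3y_1+\frac{w_3}{w_1}a+\frac{w_3}{w_2}b\Big)\\ =&(w_2w_3)^n\sum_{a=0}^{w_2d-1}\sum_{b=0}^{w_3d-1}(-1)^{a+b}\chi(ab)E_{n,\chi}\Big(w_1y_1+\frac{w_1}{w_2}a+\frac{w_1}{w_3}b\Big)\\ =&(w_3w_1)^n\sum_{a=0}^{w_3d-1}\sum_{b=0}^{w_1d-1}(-1)^{a+b}\chi(ab)E_{n,\chi}\Big(w_2y_1+\frac{w_2}{w_3}a+\frac{w_2}{w_1}b\Big). \end{align*}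
   Context: $p$ is a fixed odd prime, $\mathbb{Z}_p$ is the ring of $p$-adic integers, and $\mathbb{C}_p$ is the completion of an algebraic closure of $\mathbb{Q}_p$. $d$ is a fixed odd positive integer and $\chi$ is a (primitive) Dirichlet character of conductor $d$, with values in $\overline{\mathbb{Q}}$, regarded as $\mathbb{C}_p$-valued through a fixed embedding $\overline{\mathbb{Q}}\to\mathbb{C}_p$; as usual $\chi(a)=0$ when $\gcd(a,d)>1$ (and $\chi\equiv 1$ if $d=1$). The generalized Euler polynomials $E_{n,\chi}(x)$ attached to $\chi$ are the polynomials in $x$ (with coefficients in $\mathbb{C}_p$, so they can be evaluated at any element of $\mathbb{C}_p$) defined by $$\frac{2e^{xt}}{e^{dt}+1}\sum_{a=0}^{d-1}(-1)^a\chi(a)e^{at}=\sum_{n=0}^{\infty}E_{n,\chi}(x)\frac{t^n}{n!}.$$ *)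

theory Defs
  imports
    "HOL-Analysis.Abstract_Metric_Spaces"
    "HOL-Computational_Algebra.Computational_Algebra"
    "HOL-Number_Theory.Cong"
begin

text \<open>
  The field of \<open>p\<close>-adic complex numbers is only determined up to isometric isomorphism, so it
  is rendered by a predicate on pairs of a field (a type) and an absolute value on it, which
  says literally that the field is a completion of an algebraic closure of \<open>\<rat>\<^sub>p\<close>.
  Here \<open>\<rat>\<^sub>p\<close> is the completion of the rationals inside the ambient complete field,
  i.e. their topological closure.
\<close>

definition val_dist :: "('a::field_char_0 \<Rightarrow> real) \<Rightarrow> 'a \<Rightarrow> 'a \<Rightarrow> real" where
  "val_dist v x y = v (x - y)"

definition val_closure :: "('a::field_char_0 \<Rightarrow> real) \<Rightarrow> 'a set \<Rightarrow> 'a set" where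
  "val_closure v S = Metric_space.mtopology UNIV (val_dist v) closure_of S"

definition padic_rationals :: "('a::field_char_0 \<Rightarrow> real) \<Rightarrow> 'a set" where
  "padic_rationals v = val_closure v \<rat>"

definition padic_integers :: "('a::field_char_0 \<Rightarrow> real) \<Rightarrow> 'a set" where
  "padic_integers v = {x \<in> padic_rationals v. v x \<le> 1}"

definition algebraic_elements :: "'a::field set \<Rightarrow> 'a set" where
  "algebraic_elements F =
     {x. \<exists>f :: 'a poly. f \<noteq> 0 \<and> (\<forall>i. coeff f i \<in> F) \<and> poly f x = 0}"

definition algebraically_closed_set :: "'a::field set \<Rightarrow> bool" where
  "algebraically_closed_set F \<longleftrightarrow>
     (\<forall>f :: 'a poly. degree f > 0 \<and> (\<forall>i. coeff f i \<in> F) \<longrightarrow> (\<exists>x\<in>F. poly f x = 0))"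

definition nonarch_absolute_value :: "('a::field \<Rightarrow> real) \<Rightarrow> bool" where
  "nonarch_absolute_value v \<longleftrightarrow>
     (\<forall>x. v x \<ge> 0) \<and> (\<forall>x. v x = 0 \<longleftrightarrow> x = 0) \<and>
     (\<forall>x y. v (x * y) = v x * v y) \<and> (\<forall>x y. v (x + y) \<le> max (v x) (v y))"

text \<open>
  The second conjunct normalises \<open>v\<close> to be the \<open>p\<close>-adic absolute value on \<open>\<int>\<close>, hence on \<open>\<rat>\<close>
  by multiplicativity.  Under the first and third conjuncts, \<open>padic_rationals v\<close> is a completion
  of \<open>\<rat>\<close>; under the fourth, its algebraic elements form an algebraic closure of it.
\<close>

definition padic_complex_field :: "nat \<Rightarrow> ('a::field_char_0 \<Rightarrow> real) \<Rightarrow> bool" where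
  "padic_complex_field p v \<longleftrightarrow>
     nonarch_absolute_value v \<and>
     (\<forall>k::int. k \<noteq> 0 \<longrightarrow> v (of_int k) = inverse (real p ^ multiplicity (int p) k)) \<and>
     Metric_space.mcomplete UNIV (val_dist v) \<and>
     algebraically_closed_set (algebraic_elements (padic_rationals v)) \<and>
     val_closure v (algebraic_elements (padic_rationals v)) = UNIV"

text \<open>
  The algebraic closure of \<open>\<rat>\<close> is taken to be the set of algebraic complex numbers; only the
  values of \<open>\<iota>\<close> on this set are constrained.
\<close>

definition algebraic_embedding :: "(complex \<Rightarrow> 'a::field_char_0) \<Rightarrow> bool" where
  "algebraic_embedding \<iota> \<longleftrightarrow>
     \<iota> 1 = 1 \<and>
     (\<forall>x y. algebraic x \<and> algebraic y \<longrightarrow> \<iota> (x + y) = \<iota> x + \<iota> y \<and> \<iota> (x * y) = \<iota> x * \<iota> y) \<and>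
     inj_on \<iota> {x. algebraic x}"

definition dirichlet_character :: "nat \<Rightarrow> (nat \<Rightarrow> complex) \<Rightarrow> bool" where
  "dirichlet_character d chi \<longleftrightarrow>
     d > 0 \<and> chi 1 = 1 \<and>
     (\<forall>a b. chi (a * b) = chi a * chi b) \<and>
     (\<forall>a. chi (a + d) = chi a) \<and>
     (\<forall>a. chi a = 0 \<longleftrightarrow> \<not> coprime a d)"

definition induced_modulus :: "nat \<Rightarrow> (nat \<Rightarrow> complex) \<Rightarrow> nat \<Rightarrow> bool" where
  "induced_modulus d chi m \<longleftrightarrow>
     m dvd d \<and> (\<forall>a. coprime a d \<and> [a = 1] (mod m) \<longrightarrow> chi a = 1)"

definition primitive_dirichlet_character :: "nat \<Rightarrow> (nat \<Rightarrow> complex) \<Rightarrow> bool" where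
  "primitive_dirichlet_character d chi \<longleftrightarrow>
     dirichlet_character d chi \<and> (\<forall>m. induced_modulus d chi m \<longrightarrow> m = d)"

text \<open>
  The factor of the generating function that does not involve \<open>x\<close>.  The denominator has constant
  term \<open>2\<close>, so it is a unit and the division of power series is exact.
\<close>

definition gen_euler_kernel :: "nat \<Rightarrow> (nat \<Rightarrow> 'a::field_char_0) \<Rightarrow> 'a fps" where
  "gen_euler_kernel d \<psi> =
     2 / (fps_exp (of_nat d) + 1) *
     (\<Sum>a<d. fps_const ((-1) ^ a * \<psi> a) * fps_exp (of_nat a))"

text \<open>
  The defining identity is read in the ring of formal power series in \<open>t\<close> over polynomials
  in \<open>x\<close>; the first factor is \<open>e\<^bsup>xt\<^esup>\<close>.
\<close>

definition gen_euler_poly :: "nat \<Rightarrow> (nat \<Rightarrow> 'a::field_char_0) \<Rightarrow> nat \<Rightarrow> 'a poly" where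
  "gen_euler_poly d \<psi> n =
     smult (fact n)
       (fps_nth (Abs_fps (\<lambda>k. monom (1 / fact k) k) *
                 Abs_fps (\<lambda>k. [:fps_nth (gen_euler_kernel d \<psi>) k:])) n)"

lemma gen_euler_poly_generating_function:
  fixes \<psi> :: "nat \<Rightarrow> 'a::field_char_0"
  shows "2 * fps_exp x / (fps_exp (of_nat d) + 1) *
           (\<Sum>a<d. fps_const ((-1) ^ a * \<psi> a) * fps_exp (of_nat a)) =
         Abs_fps (\<lambda>n. poly (gen_euler_poly d \<psi> n) x / fact n)"
proof -
  let ?D = "fps_exp (of_nat d) + 1 :: 'a fps"
  have D: "fps_nth ?D 0 \<noteq> 0" by simp
  have "2 * fps_exp x / ?D = fps_exp x * (2 / ?D)"
    using D by (simp add: fps_divide_unit algebra_simps)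
  then have "2 * fps_exp x / ?D * (\<Sum>a<d. fps_const ((-1) ^ a * \<psi> a) * fps_exp (of_nat a)) =
      fps_exp x * gen_euler_kernel d \<psi>"
    unfolding gen_euler_kernel_def by (simp only: mult.assoc)
  also have "\<dots> = Abs_fps (\<lambda>n. poly (gen_euler_poly d \<psi> n) x / fact n)"
    by (rule fps_ext)
       (simp add: gen_euler_poly_def fps_mult_nth poly_sum poly_monom mult.commute)
  finally show ?thesis .
qed

end

(* The generating function of the first expression, multiplied by 4, is
   e^(w1 w2 w3 y t) K(w1 w2 t) K(w2 w3 t) K(w3 w1 t) (e^(w1 w2 w3 d t) + 1)^2
   where K is the generating function of the generalized Euler numbers: for odd w the
   alternating character sum over a < w d equals K(t) (e^(w d t) + 1) / 2. This is
   invariant under permutations of the w's. *)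

theory Submission
  imports Defs "HOL-Number_Theory.Residues"
begin

lemma periodic_add_mult:
  fixes f :: "nat \<Rightarrow> 'b"
  assumes "\<And>a. f (a + d) = f a"
  shows "f (a + k * d) = f a"
proof (induction k)
  case (Suc k)
  have "f (a + Suc k * d) = f ((a + k * d) + d)"
    by (simp only: mult_Suc add_ac)
  also have "\<dots> = f a"
    by (simp only: assms Suc.IH)
  finally show ?case .
qed simp

text \<open>By Euler's theorem every nonzero value is a root of unity. This is needed because
  \<open>algebraic_embedding\<close> constrains \<open>\<iota>\<close> on algebraic numbers
  only.\<close>

lemma algebraic_dirichlet_character:
  assumes "dirichlet_character d chi"
  shows "algebraic (chi a)"
proof (cases "coprime a d")
  case False
  then have "chi a = 0"
    using assms by (auto simp: dirichlet_character_def)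
  then show ?thesis by simp
next
  case True
  have d: "d > 0" and one: "chi 1 = 1" and mult: "chi (x * y) = chi x * chi y"
    and per: "chi (x + d) = chi x" for x y
    using assms by (auto simp: dirichlet_character_def)
  have pow: "chi (a ^ k) = chi a ^ k" for k
    using one by (induction k) (simp_all add: mult)
  have mod: "chi x = chi (x mod d)" for x
    using periodic_add_mult[of chi d "x mod d" "x div d", OF per] by simp
  have "[a ^ totient d = 1] (mod d)"
    using True by (rule euler_theorem)
  then have "chi (a ^ totient d) = chi 1"
    unfolding cong_def using mod[of "a ^ totient d"] mod[of 1] by metis
  then have "chi a ^ totient d = 1"
    by (simp only: pow one)
  \<comment> \<open>A monic integer polynomial taking the algebraic value 1 at \<open>chi a\<close>;
    \<open>d > 0\<close> makes its degree positive.\<close>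
  then have "poly (Polynomial.monom 1 (totient d)) (chi a) = 1"
    by (simp add: poly_monom)
  with d show ?thesis
    using algebraic_root[of 1 "Polynomial.monom 1 (totient d)" "chi a"]
    by (simp add: degree_monom_eq)
qed

lemma algebraic_embedding_dirichlet_character_mult:
  assumes "algebraic_embedding \<iota>" "dirichlet_character d chi"
  shows "\<iota> (chi (a * b)) = \<iota> (chi a) * \<iota> (chi b)"
  using assms algebraic_dirichlet_character[OF assms(2)]
  by (simp add: algebraic_embedding_def dirichlet_character_def)

text \<open>Cut the range into \<open>w\<close> blocks of length \<open>d\<close>. By periodicity,
  block k is the first block times (-e^(dt))^k, so a geometric sum with ratio -e^(dt) appears;
  multiplying by 1 + e^(dt) telescopes it.\<close>

lemma alternating_sum_fps_exp:
  fixes \<psi> :: "nat \<Rightarrow> 'a::field_char_0"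
  assumes "odd d" and per: "\<And>a. \<psi> (a + d) = \<psi> a"
  shows "(\<Sum>a<w * d. fps_const ((-1) ^ a * \<psi> a) * fps_exp (of_nat a)) * (fps_exp (of_nat d) + 1) =
    (\<Sum>a<d. fps_const ((-1) ^ a * \<psi> a) * fps_exp (of_nat a)) * (1 - (- fps_exp (of_nat d)) ^ w)"
proof (induction w)
  case 0
  show ?case by simp
next
  case (Suc w)
  let ?f = "\<lambda>a. fps_const ((-1) ^ a * \<psi> a) * fps_exp (of_nat a)"
  have per': "\<psi> (a + k * d) = \<psi> a" for a k
    by (rule periodic_add_mult) (rule per)
  have shift: "?f (a + w * d) = (- fps_exp (of_nat d)) ^ w * ?f a" for a
  proof -
    \<comment> \<open>The sign (-1)^(wd) reduces to (-1)^w since \<open>d\<close> is odd.\<close>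
    have "(-1 :: 'a) ^ (a + w * d) = (-1) ^ w * (-1) ^ a"
      using \<open>odd d\<close> by (simp add: power_add minus_one_power_iff)
    moreover have "fps_exp (of_nat (a + w * d) :: 'a) = fps_exp (of_nat d) ^ w * fps_exp (of_nat a)"
      by (simp add: fps_exp_add_mult fps_exp_power_mult mult.commute)
    moreover have "(- fps_exp (of_nat d :: 'a)) ^ w = fps_const ((-1) ^ w) * fps_exp (of_nat d) ^ w"
      by (simp add: minus_one_power_iff power_minus[of "fps_exp (of_nat d)"] flip: fps_const_neg)
    ultimately show ?thesis
      by (simp only: per' fps_const_mult[symmetric]) (simp only: mult_ac)
  qed
  have "(\<Sum>a<Suc w * d. ?f a) = (\<Sum>a<w * d. ?f a) + (\<Sum>a<d. ?f (a + w * d))"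
    using sum.atLeastLessThan_concat[of 0 "w * d" "Suc w * d" ?f]
      sum.shift_bounds_nat_ivl[of ?f 0 "w * d" d]
    by (simp only: lessThan_atLeast0 add_0 mult_Suc le_add2 le0 simp_thms)
  also have "\<dots> = (\<Sum>a<w * d. ?f a) + (- fps_exp (of_nat d)) ^ w * (\<Sum>a<d. ?f a)"
    unfolding shift sum_distrib_left ..
  finally show ?case
    using Suc.IH by (simp add: algebra_simps)
qed

text \<open>For odd \<open>w\<close> the factor 1 - (-e^(dt))^w is e^(wdt) + 1, and the case
  \<open>w = 1\<close> is the numerator of the kernel.\<close>

lemma alternating_sum_fps_exp_kernel:
  fixes \<psi> :: "nat \<Rightarrow> 'a::field_char_0"
  assumes "odd d" "odd w" "\<And>a. \<psi> (a + d) = \<psi> a"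
  shows "2 * (\<Sum>a<w * d. fps_const ((-1) ^ a * \<psi> a) * fps_exp (of_nat a)) =
    gen_euler_kernel d \<psi> * (fps_exp (of_nat (w * d)) + 1)"
proof -
  let ?D = "fps_exp (of_nat d) + 1 :: 'a fps"
  let ?S = "\<lambda>w. \<Sum>a<w * d. fps_const ((-1) ^ a * \<psi> a) * fps_exp (of_nat a)"
  have unit: "fps_nth ?D 0 \<noteq> 0" by simp
  then have D: "?D \<noteq> 0" by (metis fps_zero_nth)
  \<comment> \<open>The quotient is exact because the constant term of \<open>?D\<close> is 2, a
    unit.\<close>
  have "2 / ?D * ?D = 2"
    using unit by (simp add: fps_divide_unit mult.assoc inverse_mult_eq_1)
  then have K: "gen_euler_kernel d \<psi> * ?D = 2 * ?S 1"
    by (simp add: gen_euler_kernel_def mult.commute mult.left_commute)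
  have "?S w * ?D = ?S 1 * (fps_exp (of_nat (w * d)) + 1)"
    using alternating_sum_fps_exp[where \<psi> = \<psi>, OF assms(1,3), of w] \<open>odd w\<close>
    by (simp add: fps_exp_power_mult add.commute)
  then have "2 * ?S w * ?D = 2 * ?S 1 * (fps_exp (of_nat (w * d)) + 1)"
    by (simp only: mult.assoc)
  also have "\<dots> = gen_euler_kernel d \<psi> * (fps_exp (of_nat (w * d)) + 1) * ?D"
    unfolding K[symmetric] by (simp only: mult_ac)
  finally show ?thesis
    using mult_right_cancel[OF D] by (rule iffD1[rotated])
qed

text \<open>Keeping the kernel as one opaque factor lets a substitution in t act on it separately
  from e^(xt).\<close>

lemma fps_exp_mult_gen_euler_kernel:
  fixes \<psi> :: "nat \<Rightarrow> 'a::field_char_0"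
  shows "fps_exp x * gen_euler_kernel d \<psi> = Abs_fps (\<lambda>n. poly (gen_euler_poly d \<psi> n) x / fact n)"
  by (rule fps_ext) (simp add: gen_euler_poly_def fps_mult_nth poly_sum poly_monom mult.commute)

text \<open>The substitution of ct for t. It multiplies the n-th coefficient by c^n, which is how
  the outer powers such as \<open>of_nat (w1 * w2) ^ n\<close> are absorbed.\<close>

abbreviation fps_scale :: "nat \<Rightarrow> 'a::field_char_0 fps \<Rightarrow> 'a fps" where
  "fps_scale c f \<equiv> f oo (fps_const (of_nat c) * fps_X)"

lemma fps_scale_alternating_sum:
  fixes \<psi> :: "nat \<Rightarrow> 'a::field_char_0"
  assumes "odd d" "odd w" "\<And>a. \<psi> (a + d) = \<psi> a"
  shows "2 * (\<Sum>a<w * d. fps_const ((-1) ^ a * \<psi> a) * fps_exp (of_nat (c * a))) =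
    fps_scale c (gen_euler_kernel d \<psi>) * (fps_exp (of_nat (c * w * d)) + 1)"
proof -
  have "fps_scale c (2 * (\<Sum>a<w * d. fps_const ((-1) ^ a * \<psi> a) * fps_exp (of_nat a))) =
    fps_scale c (gen_euler_kernel d \<psi> * (fps_exp (of_nat (w * d)) + 1))"
    using alternating_sum_fps_exp_kernel[where \<psi> = \<psi>, OF assms] by simp
  then show ?thesis
    by (simp add: fps_compose_mult_distrib fps_compose_add_distrib fps_compose_sum_distrib
        fps_exp_compose_linear mult.assoc)
qed

text \<open>The factor 4 is one 2 for each of the two character sums. Up to commutativity, a cyclic
  shift of the w's leaves the right-hand side unchanged.\<close>

lemma gen_euler_symmetric_generating_function:
  fixes \<psi> :: "nat \<Rightarrow> 'a::field_char_0"
  assumes "odd d" "odd w1" "odd w2" "odd w3"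
    and per: "\<And>a. \<psi> (a + d) = \<psi> a" and mult: "\<And>a b. \<psi> (a * b) = \<psi> a * \<psi> b"
  shows "4 * Abs_fps (\<lambda>n. of_nat (w1 * w2) ^ n *
       (\<Sum>a<w1 * d. \<Sum>b<w2 * d. (-1) ^ (a + b) * \<psi> (a * b) *
          poly (gen_euler_poly d \<psi> n)
            (of_nat w3 * y + of_nat w3 / of_nat w1 * of_nat a
               + of_nat w3 / of_nat w2 * of_nat b)) / fact n) =
    fps_exp (of_nat (w1 * w2 * w3) * y) *
      (fps_scale (w1 * w2) (gen_euler_kernel d \<psi>) * fps_scale (w2 * w3) (gen_euler_kernel d \<psi>) *
       fps_scale (w3 * w1) (gen_euler_kernel d \<psi>)) *
      (fps_exp (of_nat (w1 * w2 * w3 * d)) + 1) ^ 2"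
    (is "4 * ?L = ?R")
proof -
  let ?K = "gen_euler_kernel d \<psi>"
  let ?x = "\<lambda>a b. of_nat w3 * y + of_nat w3 / of_nat w1 * of_nat a + of_nat w3 / of_nat w2 * of_nat b"
  let ?E = "fps_exp (of_nat (w1 * w2 * w3) * y)"
  let ?S = "\<lambda>w c. \<Sum>a<w * d. fps_const ((-1) ^ a * \<psi> a) * fps_exp (of_nat (c * a))"
  have nz: "of_nat w1 \<noteq> (0 :: 'a)" "of_nat w2 \<noteq> (0 :: 'a)"
    using \<open>odd w1\<close> \<open>odd w2\<close> by (auto simp: odd_pos)
  have "?L = (\<Sum>a<w1 * d. \<Sum>b<w2 * d. fps_const ((-1) ^ (a + b) * \<psi> (a * b)) *
      fps_scale (w1 * w2) (fps_exp (?x a b) * ?K))"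
    unfolding fps_exp_mult_gen_euler_kernel
    by (rule fps_ext)
       (simp only: fps_sum_nth fps_nth_compose_linear fps_nth_Abs_fps fps_mult_left_const_nth
          sum_distrib_left sum_divide_distrib, simp only: times_divide_eq_right mult_ac)
  also have "\<dots> = (\<Sum>a<w1 * d. \<Sum>b<w2 * d. ?E * fps_scale (w1 * w2) ?K *
      ((fps_const ((-1) ^ a * \<psi> a) * fps_exp (of_nat (w2 * w3 * a))) *
       (fps_const ((-1) ^ b * \<psi> b) * fps_exp (of_nat (w3 * w1 * b)))))"
  proof (intro sum.cong refl)
    fix a b
    \<comment> \<open>Scaling by \<open>w1 * w2\<close> clears both denominators, so the exponential
      splits into a factor in \<open>a\<close>, a factor in \<open>b\<close> and one free of
      both.\<close>
    have arg: "of_nat (w1 * w2) * ?x a b =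
        of_nat (w1 * w2 * w3) * y + of_nat (w2 * w3 * a) + of_nat (w3 * w1 * b)"
      using nz by (simp add: field_simps)
    have 1: "fps_scale (w1 * w2) (fps_exp (?x a b)) =
        ?E * fps_exp (of_nat (w2 * w3 * a)) * fps_exp (of_nat (w3 * w1 * b))"
      by (simp only: fps_exp_compose_linear arg flip: fps_exp_add_mult)
    \<comment> \<open>Complete multiplicativity separates \<open>a\<close> from \<open>b\<close>, so
      that the double sum becomes a product of two single sums.\<close>
    have 2: "fps_const ((-1) ^ (a + b) * \<psi> (a * b)) =
        fps_const ((-1) ^ a * \<psi> a) * fps_const ((-1) ^ b * \<psi> b)"
      by (simp add: mult power_add mult_ac)
    have 3: "fps_scale (w1 * w2) (fps_exp (?x a b) * ?K) =
        fps_scale (w1 * w2) (fps_exp (?x a b)) * fps_scale (w1 * w2) ?K"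
      by (rule fps_compose_mult_distrib) simp
    show "fps_const ((-1) ^ (a + b) * \<psi> (a * b)) *
        fps_scale (w1 * w2) (fps_exp (?x a b) * ?K) = ?E * fps_scale (w1 * w2) ?K *
      ((fps_const ((-1) ^ a * \<psi> a) * fps_exp (of_nat (w2 * w3 * a))) *
       (fps_const ((-1) ^ b * \<psi> b) * fps_exp (of_nat (w3 * w1 * b))))"
      unfolding 1 2 3 by (simp only: mult_ac)
  qed
  also have "\<dots> = ?E * fps_scale (w1 * w2) ?K * (?S w1 (w2 * w3) * ?S w2 (w3 * w1))"
    unfolding sum_product by (simp only: sum_distrib_left)
  finally have L: "?L = ?E * fps_scale (w1 * w2) ?K * (?S w1 (w2 * w3) * ?S w2 (w3 * w1))" .
  have "4 * (e * (s * t)) = e * ((2 * s) * (2 * t))" for e s t :: "'a fps"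
    by simp
  then have "4 * ?L = ?E * fps_scale (w1 * w2) ?K * ((2 * ?S w1 (w2 * w3)) * (2 * ?S w2 (w3 * w1)))"
    unfolding L .
  also have "\<dots> = ?R"
    unfolding fps_scale_alternating_sum[where \<psi> = \<psi>, OF \<open>odd d\<close> \<open>odd w1\<close> per]
      fps_scale_alternating_sum[where \<psi> = \<psi>, OF \<open>odd d\<close> \<open>odd w2\<close> per]
    by (simp only: power2_eq_square mult_ac)
  finally show ?thesis .
qed

theorem theorem4p6:
  fixes p d n w1 w2 w3 :: nat
    and v :: "'a::field_char_0 \<Rightarrow> real"
    and \<iota> :: "complex \<Rightarrow> 'a"
    and chi :: "nat \<Rightarrow> complex"
    and y1 :: 'a
  assumes "prime p" and "odd p"
    and "padic_complex_field p v"
    and "algebraic_embedding \<iota>"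
    and "odd d"
    and "primitive_dirichlet_character d chi"
    and "odd w1" and "odd w2" and "odd w3"
    and "y1 \<in> padic_integers v"
  shows
    "of_nat (w1 * w2) ^ n *
       (\<Sum>a<w1 * d. \<Sum>b<w2 * d. (-1) ^ (a + b) * \<iota> (chi (a * b)) *
          poly (gen_euler_poly d (\<lambda>c. \<iota> (chi c)) n)
            (of_nat w3 * y1 + of_nat w3 / of_nat w1 * of_nat a
               + of_nat w3 / of_nat w2 * of_nat b)) =
     of_nat (w2 * w3) ^ n *
       (\<Sum>a<w2 * d. \<Sum>b<w3 * d. (-1) ^ (a + b) * \<iota> (chi (a * b)) *
          poly (gen_euler_poly d (\<lambda>c. \<iota> (chi c)) n)
            (of_nat w1 * y1 + of_nat w1 / of_nat w2 * of_nat a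
               + of_nat w1 / of_nat w3 * of_nat b)) \<and>
     of_nat (w2 * w3) ^ n *
       (\<Sum>a<w2 * d. \<Sum>b<w3 * d. (-1) ^ (a + b) * \<iota> (chi (a * b)) *
          poly (gen_euler_poly d (\<lambda>c. \<iota> (chi c)) n)
            (of_nat w1 * y1 + of_nat w1 / of_nat w2 * of_nat a
               + of_nat w1 / of_nat w3 * of_nat b)) =
     of_nat (w3 * w1) ^ n *
       (\<Sum>a<w3 * d. \<Sum>b<w1 * d. (-1) ^ (a + b) * \<iota> (chi (a * b)) *
          poly (gen_euler_poly d (\<lambda>c. \<iota> (chi c)) n)
            (of_nat w2 * y1 + of_nat w2 / of_nat w3 * of_nat a
               + of_nat w2 / of_nat w1 * of_nat b))"
proof -
  let ?\<psi> = "\<lambda>c. \<iota> (chi c)"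
  let ?F = "\<lambda>w1 w2 w3 n. of_nat (w1 * w2) ^ n *
       (\<Sum>a<w1 * d. \<Sum>b<w2 * d. (-1) ^ (a + b) * ?\<psi> (a * b) *
          poly (gen_euler_poly d ?\<psi> n)
            (of_nat w3 * y1 + of_nat w3 / of_nat w1 * of_nat a
               + of_nat w3 / of_nat w2 * of_nat b))"
  have chi: "dirichlet_character d chi"
    using assms by (simp add: primitive_dirichlet_character_def)
  then have per: "?\<psi> (a + d) = ?\<psi> a" for a
    by (simp add: dirichlet_character_def)
  have mult: "?\<psi> (a * b) = ?\<psi> a * ?\<psi> b" for a b
    using assms(4) chi by (rule algebraic_embedding_dirichlet_character_mult)
  \<comment> \<open>Both claimed equalities are instances of one cyclic shift, starting from
    \<open>w1, w2, w3\<close> and from \<open>w2, w3, w1\<close>.\<close>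
  have rotate: "?F u1 u2 u3 n = ?F u2 u3 u1 n" if "odd u1" "odd u2" "odd u3" for u1 u2 u3
  proof -
    note gf = gen_euler_symmetric_generating_function[where \<psi> = ?\<psi> and y = y1, OF \<open>odd d\<close> _ _ _ per mult]
    \<comment> \<open>Here \<open>n\<close> is rebound, so all degrees are compared at once; 4 and
      \<open>fact n\<close> then cancel because the characteristic is 0.\<close>
    have "4 * Abs_fps (\<lambda>n. ?F u1 u2 u3 n / fact n) = 4 * Abs_fps (\<lambda>n. ?F u2 u3 u1 n / fact n)"
      unfolding gf[OF that] gf[OF that(2,3,1)] by (simp only: mult_ac)
    then have "Abs_fps (\<lambda>n. ?F u1 u2 u3 n / fact n) = Abs_fps (\<lambda>n. ?F u2 u3 u1 n / fact n)"
      by (simp only: mult_cancel_left) simp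
    then have "?F u1 u2 u3 n / fact n = ?F u2 u3 u1 n / fact n"
      by (simp only: fps_eq_iff fps_nth_Abs_fps)
    then show ?thesis by (simp only: divide_cancel_right) simp
  qed
  show ?thesis
    using rotate[of w1 w2 w3] rotate[of w2 w3 w1] assms by blast
qed

end
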